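(* Let $T$ be a partially ordered set and $\mu$ a probability measure on $T$. Then the probability generating functions of the run lengths are $$G_{N_0^{<}}(Z)=\frac{1+(Z-1)P^{<}_\mu(Z)}{Z},\qquad G_{N_0^{\le}}(Z)=\frac{1+(Z-1)P^{\le}_\mu(Z)}{Z},$$ and, when $i\ge1$, $$G_{N_i^{<}}(Z)=1+\frac{2(Z-1)}{Z\,(2-(P^{<}_\mu)''(0))}\,G_{N_0^{<}}(Z),\qquad G_{N_i^{\le}}(Z)=1+\frac{2(Z-1)}{Z\,(2-(P^{\le}_\mu)''(0))}\,G_{N_0^{\le}}(Z).$$ Further, the radius of convergence of $G_{N_i^{<}}(Z)$ is infinite, and the radius of convergence of $G_{N_i^{\le}}(Z)$ is greater than or equal to $\frac{1}{\|\mu\|}$, with equality when $\mu$ is degenerate.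
   Context: $T$ carries its Borel $\sigma$-algebra, on which measures on $T$ are defined, and it is assumed that $\{(x,y)\in T^2:x<y\}$ is measurable (so that the event $\{X_0<X_1\}$ below is measurable). $\|\mu\|=\mu(T)$, which equals $1$ for a probability measure. $\mu$ is degenerate if there is $x\in T$ with $\mu(\{x\})=\mu(T)$, and non-degenerate otherwise. Run functions: for a finite non-negative measure $\mu$ on $T$, the strict and non-strict run functions are the formal power series $$P^{<}_\mu(Z)=1+\mu(T)Z+\sum_{n=2}^\infty\mu^n(\{(a_1,\dots,a_n)\in T^n:a_1<\dots<a_n\})Z^n,$$ $$P^{\le}_\mu(Z)=1+\mu(T)Z+\sum_{n=2}^\infty\mu^n(\{(a_1,\dots,a_n)\in T^n:a_1\le\dots\le a_n\})Z^n,$$ where $\mu^n$ is the $n$-fold product measure and $Z$ is a formal indeterminate; $P''(0)$ is twice the coefficient of $Z^2$. Runs: $X_0,X_1,X_2,\dots$ are i.i.d. $T$-valued random variables with law $\mu$ on a probability space $(\Omega,\mathcal{F},\mathbb{P})$. For $i\ge0$, the event that a strict run begins at $i$ is $S_0^{<}=\Omega$ and $S_i^{<}=\{X_{i-1}\not< X_i\}$ for $i\ge1$; the event that a non-strict run begins at $i$ is $S_0^{\le}=\Omega$ and $S_i^{\le}=\{X_{i-1}\not\le X_i\}$ for $i\ge1$. The run length $N_i^{<}$ is defined only on $S_i^{<}$, with values in $\{1,2,\dots\}\cup\{\infty\}$: for finite $n\ge1$, $\{N_i^{<}=n\}=S_i^{<}\cap\{X_i<X_{i+1}<\dots<X_{i+n-1}\}\cap\{X_{i+n-1}\not<X_{i+n}\}$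 (the chain condition being vacuous for $n=1$), and $\{N_i^{<}=\infty\}=S_i^{<}\cap\{X_i<X_{i+1}<\cdots\}$. $N_i^{\le}$ is defined on $S_i^{\le}$ in the same way with $<,\not<$ replaced by $\le,\not\le$. The probability generating functions are the formal power series $G_{N_i^{<}}(Z)=\sum_{n=0}^\infty\mathbb{P}(N_i^{<}=n\mid S_i^{<})Z^n$ and $G_{N_i^{\le}}(Z)=\sum_{n=0}^\infty\mathbb{P}(N_i^{\le}=n\mid S_i^{\le})Z^n$.
   Formalization: For degenerate μ the radius equality is stated for P^≤ rather than G (there G_{N_0^≤}=0 has infinite radius); the non-strict formula for i≥1 excludes degenerate μ, where it divides by 0; the non-strict claims assume {x≤y} measurable. *)

theory Defs
  imports "HOL-Probability.Probability" "HOL-Computational_Algebra.Formal_Laurent_Series"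
begin

text \<open>The relation \<open>R\<close> below is \<open>(<)\<close> for strict and \<open>(\<le>)\<close> for non-strict runs.
  A point \<open>(a\<^sub>1, \<dots>, a\<^sub>n)\<close> of the \<open>n\<close>-th power of \<open>M\<close> is an extensional function on \<open>{1..n}\<close>.\<close>

definition run_function :: "('a \<Rightarrow> 'a \<Rightarrow> bool) \<Rightarrow> 'a measure \<Rightarrow> real fps" where
  "run_function R M =
     1 + fps_const (measure M (space M)) * fps_X +
     Abs_fps (\<lambda>n. if n \<ge> 2 then
         measure (\<Pi>\<^sub>M j\<in>{1..n}. M)
           {a \<in> space (\<Pi>\<^sub>M j\<in>{1..n}. M). \<forall>j\<in>{1..<n}. R (a j) (a (Suc j))}
       else 0)"

definition degenerate :: "'a measure \<Rightarrow> bool" where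
  "degenerate M \<longleftrightarrow> (\<exists>x\<in>space M. {x} \<in> sets M \<and> measure M {x} = measure M (space M))"

definition run_begins :: "('a \<Rightarrow> 'a \<Rightarrow> bool) \<Rightarrow> (nat \<Rightarrow> 'w \<Rightarrow> 'a) \<Rightarrow> nat \<Rightarrow> 'w \<Rightarrow> bool" where
  "run_begins R X i \<omega> \<longleftrightarrow> i = 0 \<or> \<not> R (X (i - 1) \<omega>) (X i \<omega>)"

text \<open>The length of the run beginning at \<open>i\<close>. It is meaningful only where a run begins at \<open>i\<close>;
  its values elsewhere do not matter, because its law is only considered conditionally on
  \<open>run_begins R X i\<close>.\<close>

definition run_length :: "('a \<Rightarrow> 'a \<Rightarrow> bool) \<Rightarrow> (nat \<Rightarrow> 'w \<Rightarrow> 'a) \<Rightarrow> nat \<Rightarrow> 'w \<Rightarrow> enat" where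
  "run_length R X i \<omega> =
     (if \<exists>k. \<not> R (X (i + k) \<omega>) (X (i + k + 1) \<omega>)
      then enat (Suc (LEAST k. \<not> R (X (i + k) \<omega>) (X (i + k + 1) \<omega>)))
      else \<infinity>)"

lemma run_length_eq_enat_iff:
  "run_length R X i \<omega> = enat n \<longleftrightarrow>
     n \<ge> 1 \<and> (\<forall>k<n - 1. R (X (i + k) \<omega>) (X (i + k + 1) \<omega>)) \<and>
     \<not> R (X (i + n - 1) \<omega>) (X (i + n) \<omega>)"
proof (cases n)
  case 0
  then show ?thesis by (simp add: run_length_def zero_enat_def[symmetric] enat_0_iff)
next
  case (Suc m)
  define Q where "Q k \<longleftrightarrow> \<not> R (X (i + k) \<omega>) (X (i + k + 1) \<omega>)" for k
  have "(\<exists>k. Q k) \<and> (LEAST k. Q k) = m \<longleftrightarrow> (\<forall>k<m. \<not> Q k) \<and> Q m"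
    by (metis LeastI Least_equality not_less_Least linorder_not_less)
  moreover have "run_length R X i \<omega> = (if \<exists>k. Q k then enat (Suc (LEAST k. Q k)) else \<infinity>)"
    by (simp add: run_length_def Q_def)
  ultimately have "run_length R X i \<omega> = enat n \<longleftrightarrow> (\<forall>k<m. \<not> Q k) \<and> Q m"
    using Suc by auto
  then show ?thesis using Suc by (simp add: Q_def)
qed

lemma run_length_eq_infinity_iff:
  "run_length R X i \<omega> = \<infinity> \<longleftrightarrow> (\<forall>k. R (X (i + k) \<omega>) (X (i + k + 1) \<omega>))"
  by (auto simp: run_length_def)

definition run_length_pgf ::
    "('a \<Rightarrow> 'a \<Rightarrow> bool) \<Rightarrow> 'w measure \<Rightarrow> (nat \<Rightarrow> 'w \<Rightarrow> 'a) \<Rightarrow> nat \<Rightarrow> real fps" where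
  "run_length_pgf R P X i =
     Abs_fps (\<lambda>n. \<P>(\<omega> in P. run_length R X i \<omega> = enat n \<bar> run_begins R X i \<omega>))"

end

theory Submission
  imports Defs
begin

text \<open>Let \<open>c n\<close> be the coefficient of \<open>Z\<^sup>n\<close> in the run function, i.e. the probability that \<open>n\<close> variables of
  the sequence, taken at any \<open>n\<close> different indices, form a chain (below: \<open>chain_prob\<close>). A run starting
  at \<open>0\<close> has length \<open>n\<close> iff \<open>X 0, \<dots>, X (n - 1)\<close> is a chain that does not extend to \<open>X n\<close>, which has
  probability \<open>c n - c (n + 1)\<close>. Starting at \<open>i \<ge> 1\<close>, the chain must not extend to the left either,
  and the law is the second difference of \<open>c\<close> divided by the probability \<open>1 - c 2\<close> that a run starts.
  For a strict order, exchangeability gives \<open>c n \<le> 1 / n!\<close>, hence the infinite radius. For a weak order,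
  \<open>c 2 = 1\<close> means by symmetry that two independent copies agree almost surely, so that \<open>\<mu>\<close> has an
  atom of mass \<open>1\<close>.\<close>

section \<open>Comparison of radii of convergence\<close>

lemma conv_radius_mono:
  fixes f g :: "nat \<Rightarrow> 'a :: {banach, real_normed_div_algebra}"
  assumes "\<And>n. norm (f n) \<le> norm (g n)"
  shows "conv_radius g \<le> conv_radius f"
proof (rule conv_radius_geI_ex')
  fix r :: real assume r: "0 < r" "ereal r < conv_radius g"
  have "summable (\<lambda>n. norm (g n * of_real r ^ n))"
    using r by (intro abs_summable_in_conv_radius) auto
  then show "summable (\<lambda>n. f n * of_real r ^ n)"
    by (rule summable_comparison_test'[where N = 0])
       (use assms r in \<open>auto simp: norm_mult intro!: mult_right_mono\<close>)
qed

lemma conv_radius_one: "conv_radius (\<lambda>_. 1 :: real) = 1"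
  using conv_radius_ratio_limit[of 1 1 "\<lambda>_. 1 :: real"] by (simp add: one_ereal_def)

section \<open>Joint laws in an i.i.d. sequence\<close>

locale iid_sequence = prob_space P for P :: "'w measure" +
  fixes M :: "'a measure" and X :: "nat \<Rightarrow> 'w \<Rightarrow> 'a"
  assumes indep: "indep_vars (\<lambda>_. M) X UNIV"
    and law: "distr P M (X i) = M"
begin

lemma measurable_X [measurable]: "X i \<in> measurable P M"
  using indep by (simp add: indep_vars_def)

sublocale M: prob_space M
  using prob_space_distr[OF measurable_X[of 0]] by (simp add: law)

text \<open>By independence and the common law the whole sequence has the infinite product law, and
  product measures are preserved when coordinates are selected injectively. This is the
  exchangeability behind every later change of indices.\<close>

lemma distr_reindex:
  assumes "inj_on s I"
  shows "distr P (\<Pi>\<^sub>M j\<in>I. M) (\<lambda>\<omega>. \<lambda>j\<in>I. X (s j) \<omega>) = (\<Pi>\<^sub>M j\<in>I. M)"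
proof -
  have [measurable]: "(\<lambda>\<omega>. \<lambda>j\<in>UNIV. X j \<omega>) \<in> measurable P (\<Pi>\<^sub>M j\<in>UNIV. M)"
    by measurable
  have "distr P (\<Pi>\<^sub>M j\<in>UNIV. M) (\<lambda>\<omega>. \<lambda>j\<in>UNIV. X j \<omega>) = (\<Pi>\<^sub>M j\<in>UNIV. M)"
    using indep indep_vars_iff_distr_eq_PiM[where I = UNIV and M' = "\<lambda>_. M" and X = X] by (simp add: law)
  then have "distr (distr P (\<Pi>\<^sub>M j\<in>UNIV. M) (\<lambda>\<omega>. \<lambda>j\<in>UNIV. X j \<omega>)) (\<Pi>\<^sub>M j\<in>I. M) (\<lambda>a. \<lambda>j\<in>I. a (s j))
      = (\<Pi>\<^sub>M j\<in>I. M)"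
    using distr_PiM_reindex[of UNIV "\<lambda>_. M" s I] assms M.prob_space_axioms by simp
  moreover have "(\<lambda>a. \<lambda>j\<in>I. a (s j)) \<in> measurable (\<Pi>\<^sub>M j\<in>UNIV. M) (\<Pi>\<^sub>M j\<in>I. M)"
    by measurable
  ultimately show ?thesis
    by (subst (asm) distr_distr) (simp_all add: o_def)
qed

text \<open>Fubini's theorem will be applied on the binary product, so the law of two variables is
  needed there. Agreement on rectangles suffices, and on these it is independence.\<close>

lemma distr_pair:
  assumes "i \<noteq> j"
  shows "distr P (M \<Otimes>\<^sub>M M) (\<lambda>\<omega>. (X i \<omega>, X j \<omega>)) = M \<Otimes>\<^sub>M M"
proof (rule sym, rule pair_measure_eqI)
  fix A B assume [measurable]: "A \<in> sets M" "B \<in> sets M"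
  have *: "emeasure M C = prob (X k -` C \<inter> space P)" if "C \<in> sets M" for C k
    using emeasure_distr[OF measurable_X that, of k] by (simp add: law emeasure_eq_measure)
  have "emeasure (distr P (M \<Otimes>\<^sub>M M) (\<lambda>\<omega>. (X i \<omega>, X j \<omega>))) (A \<times> B)
      = prob (\<Inter>k\<in>{i, j}. X k -` (if k = i then A else B) \<inter> space P)"
    using assms
    by (subst emeasure_distr) (auto simp: emeasure_eq_measure intro!: arg_cong[where f = prob])
  also have "\<dots> = prob (X i -` A \<inter> space P) * prob (X j -` B \<inter> space P)"
    by (subst indep_varsD[OF indep]) (use assms in auto)
  finally show "emeasure M A * emeasure M B
      = emeasure (distr P (M \<Otimes>\<^sub>M M) (\<lambda>\<omega>. (X i \<omega>, X j \<omega>))) (A \<times> B)"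
    by (simp add: *[of A i] *[of B j] ennreal_mult'')
qed (simp_all add: M.sigma_finite_measure_axioms)

end

section \<open>Chains and their probabilities\<close>

text \<open>\<open>R\<close> stays arbitrary so that one development serves both \<open><\<close>
  and \<open>\<le>\<close>; lemmas that depend on order properties assume them separately.\<close>

locale iid_relation = iid_sequence +
  fixes R :: "'b \<Rightarrow> 'b \<Rightarrow> bool"
  assumes measurable_rel [measurable]: "Measurable.pred (M \<Otimes>\<^sub>M M) (\<lambda>p. R (fst p) (snd p))"
begin

lemma measurable_rel_compose [measurable]:
  assumes [measurable]: "f \<in> measurable N M" "g \<in> measurable N M"
  shows "Measurable.pred N (\<lambda>x. R (f x) (g x))"
proof -
  have "Measurable.pred N (\<lambda>x. (\<lambda>p. R (fst p) (snd p)) (f x, g x))"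
    by measurable
  then show ?thesis by simp
qed

text \<open>The index map \<open>s\<close> is free: \<open>(+) i\<close> describes runs, an
  insertion map gives the factorial bound, a two-point map compares a pair in both directions.
  \<open>n\<close> counts points, so for \<open>n \<le> 1\<close> the condition is vacuous.\<close>

definition chain :: "(nat \<Rightarrow> nat) \<Rightarrow> nat \<Rightarrow> 'a \<Rightarrow> bool" where
  "chain s n \<omega> \<longleftrightarrow> (\<forall>k. Suc k < n \<longrightarrow> R (X (s k) \<omega>) (X (s (Suc k)) \<omega>))"

lemma measurable_chain [measurable]: "Measurable.pred P (chain s n)"
  unfolding chain_def by measurable


text \<open>The vector of the \<open>n\<close> selected variables has the product law, whatever the
  indices. For \<open>n \<le> 1\<close> both sides are \<open>1\<close>.\<close>

lemma run_function_nth: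
  assumes "inj_on s {..<n}"
  shows "\<P>(\<omega> in P. chain s n \<omega>) = fps_nth (run_function R M) n"
proof -
  consider "n = 0" | "n = 1" | "n \<ge> 2" by linarith
  then show ?thesis
  proof cases
    case 3
    \<comment> \<open>The product is indexed from \<open>1\<close>, chains from \<open>0\<close>;
      \<open>j - 1\<close> translates and is injective on \<open>{1..n}\<close>.\<close>
    define T where "T \<omega> = (\<lambda>j\<in>{1..n}. X (s (j - 1)) \<omega>)" for \<omega>
    define A where "A = {a \<in> space (\<Pi>\<^sub>M j\<in>{1..n}. M). \<forall>j\<in>{1..<n}. R (a j) (a (Suc j))}"
    have T [measurable]: "T \<in> measurable P (\<Pi>\<^sub>M j\<in>{1..n}. M)"
      unfolding T_def by measurable
    have A [measurable]: "A \<in> sets (\<Pi>\<^sub>M j\<in>{1..n}. M)"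
      unfolding A_def by (intro sets.sets_Collect_finite_All) auto
    have "inj_on (\<lambda>j. s (j - 1)) {1..n}"
    proof (rule inj_onI)
      fix x y assume "x \<in> {1..n}" "y \<in> {1..n}" "s (x - 1) = s (y - 1)"
      then have "x - 1 = y - 1"
        using inj_onD[OF assms, of "x - 1" "y - 1"] by auto
      then show "x = y" using \<open>x \<in> {1..n}\<close> \<open>y \<in> {1..n}\<close> by auto
    qed
    from distr_reindex[OF this] have "distr P (\<Pi>\<^sub>M j\<in>{1..n}. M) T = (\<Pi>\<^sub>M j\<in>{1..n}. M)"
      by (simp add: T_def[abs_def])
    then have "measure (\<Pi>\<^sub>M j\<in>{1..n}. M) A = prob (T -` A \<inter> space P)"
      using measure_distr[OF T A] by simp
    also have "T -` A \<inter> space P = {\<omega> \<in> space P. chain s n \<omega>}"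
    proof (intro set_eqI iffI)
      fix \<omega> assume \<omega>: "\<omega> \<in> T -` A \<inter> space P"
      have "R (X (s k) \<omega>) (X (s (Suc k)) \<omega>)" if "Suc k < n" for k
      proof -
        have "R (T \<omega> (Suc k)) (T \<omega> (Suc (Suc k)))"
          using \<omega> that by (auto simp: A_def)
        then show ?thesis using that by (simp add: T_def)
      qed
      then show "\<omega> \<in> {\<omega> \<in> space P. chain s n \<omega>}"
        using \<omega> by (auto simp: chain_def)
    next
      fix \<omega> assume \<omega>: "\<omega> \<in> {\<omega> \<in> space P. chain s n \<omega>}"
      have "R (T \<omega> j) (T \<omega> (Suc j))" if j: "j \<in> {1..<n}" for j
      proof -
        obtain k where k: "j = Suc k" using j by (cases j) auto
        then show ?thesis using j \<omega> by (simp add: T_def chain_def)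
      qed
      then show "\<omega> \<in> T -` A \<inter> space P"
        using \<omega> measurable_space[OF T] by (auto simp: A_def)
    qed
    finally show ?thesis
      using 3 by (simp add: run_function_def A_def fps_X_def)
  qed (simp_all add: chain_def run_function_def prob_space M.prob_space fps_X_def)
qed

abbreviation chain_prob :: "nat \<Rightarrow> real" where
  "chain_prob n \<equiv> fps_nth (run_function R M) n"

lemma chain_prob_0 [simp]: "chain_prob 0 = 1" and chain_prob_1 [simp]: "chain_prob (Suc 0) = 1"
  by (simp_all add: run_function_def fps_X_def M.prob_space)

lemma prob_chain: "\<P>(\<omega> in P. chain ((+) i) n \<omega>) = chain_prob n"
  by (rule run_function_nth) simp

lemma chain_antimono: "chain s n \<omega> \<Longrightarrow> m \<le> n \<Longrightarrow> chain s m \<omega>"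
  by (auto simp: chain_def)

section \<open>Runs in terms of chains\<close>

text \<open>For \<open>n = 0\<close> the left side would be vacuous while the right side would
  not.\<close>

lemma chain_shift:
  assumes "n \<ge> 1"
  shows "chain ((+) i) (Suc n) \<omega> \<longleftrightarrow> R (X i \<omega>) (X (Suc i) \<omega>) \<and> chain ((+) (Suc i)) n \<omega>"
  using assms by (cases n) (simp_all add: chain_def All_less_Suc2)

text \<open>Exhibits an exact length as a difference of two nested chain events, whose probability
  is then a difference.\<close>

lemma run_length_eq_iff:
  "run_length R X i \<omega> = enat n \<longleftrightarrow> n \<ge> 1 \<and> chain ((+) i) n \<omega> \<and> \<not> chain ((+) i) (Suc n) \<omega>"
proof (cases n)
  case (Suc m)
  then show ?thesis
    by (simp add: run_length_eq_enat_iff chain_def All_less_Suc) auto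
qed (simp add: run_length_eq_enat_iff)

lemma run_begins_Suc_iff: "run_begins R X (Suc i) \<omega> \<longleftrightarrow> \<not> chain ((+) i) 2 \<omega>"
  by (auto simp: run_begins_def chain_def less_Suc_eq numeral_2_eq_2)

lemma measurable_run_begins [measurable]: "Measurable.pred P (run_begins R X i)"
  by (cases i) (simp_all add: run_begins_Suc_iff[abs_def] run_begins_def[of _ _ 0, abs_def])

lemma prob_diff:
  assumes [measurable]: "Measurable.pred P Q" "Measurable.pred P Q'"
    and "\<And>\<omega>. Q' \<omega> \<Longrightarrow> Q \<omega>"
  shows "\<P>(\<omega> in P. Q \<omega> \<and> \<not> Q' \<omega>) = \<P>(\<omega> in P. Q \<omega>) - \<P>(\<omega> in P. Q' \<omega>)"
proof -
  have "{\<omega> \<in> space P. Q \<omega> \<and> \<not> Q' \<omega>} = {\<omega> \<in> space P. Q \<omega>} - {\<omega> \<in> space P. Q' \<omega>}"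
    by auto
  then show ?thesis
    using assms(3) by (simp add: finite_measure_Diff subset_iff)
qed

lemma prob_run_begins_Suc: "\<P>(\<omega> in P. run_begins R X (Suc i) \<omega>) = 1 - chain_prob 2"
  using prob_diff[of "\<lambda>_. True" "chain ((+) i) 2"]
  by (simp add: run_begins_Suc_iff prob_chain prob_space)

text \<open>If the points from \<open>Suc i\<close> on form a chain, a run begins there exactly when
  prepending \<open>X i\<close> does not give a chain of \<open>Suc n\<close> points.\<close>

lemma prob_begins_chain:
  assumes "n \<ge> 1"
  shows "\<P>(\<omega> in P. run_begins R X (Suc i) \<omega> \<and> chain ((+) (Suc i)) n \<omega>) = chain_prob n - chain_prob (Suc n)"
proof -
  have *: "run_begins R X (Suc i) \<omega> \<and> chain ((+) (Suc i)) n \<omega>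
      \<longleftrightarrow> chain ((+) (Suc i)) n \<omega> \<and> \<not> chain ((+) i) (Suc n) \<omega>" for \<omega>
    using chain_shift[OF assms, of i \<omega>] by (auto simp: run_begins_def)
  have "\<P>(\<omega> in P. run_begins R X (Suc i) \<omega> \<and> chain ((+) (Suc i)) n \<omega>)
      = \<P>(\<omega> in P. chain ((+) (Suc i)) n \<omega> \<and> \<not> chain ((+) i) (Suc n) \<omega>)"
    by (simp only: *)
  also have "\<dots> = chain_prob n - chain_prob (Suc n)"
    unfolding prob_chain[of "Suc i" n, symmetric] prob_chain[of i "Suc n", symmetric]
    by (rule prob_diff[OF measurable_chain measurable_chain]) (simp add: chain_shift[OF assms])
  finally show ?thesis .
qed

section \<open>Coefficients and closed forms of the generating functions\<close>

lemma pgf_0_nth: "fps_nth (run_length_pgf R P X 0) n = chain_prob n - chain_prob (Suc n)"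
proof (cases "n = 0")
  case False
  then show ?thesis
    using prob_diff[of "chain ((+) 0) n" "chain ((+) 0) (Suc n)"] chain_antimono[of _ "Suc n" _ n]
    by (simp add: run_length_pgf_def cond_prob_def run_begins_def prob_space run_length_eq_iff
        prob_chain)
qed (simp add: run_length_pgf_def cond_prob_def run_length_eq_iff)

text \<open>At \<open>n = 0\<close> the quotient would be \<open>-1\<close> if
  \<open>chain_prob 2 \<noteq> 1\<close>; the summand \<open>1\<close> in the closed form
  compensates for this.\<close>

lemma pgf_Suc_nth:
  "fps_nth (run_length_pgf R P X (Suc i)) n =
     (if n = 0 then 0 else (chain_prob n - 2 * chain_prob (Suc n) + chain_prob (Suc (Suc n))) / (1 - chain_prob 2))"
proof (cases "n = 0")
  case False
  then have n: "n \<ge> 1" by simp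
  let ?B = "run_begins R X (Suc i)" and ?C = "chain ((+) (Suc i))"
  have "\<P>(\<omega> in P. run_length R X (Suc i) \<omega> = enat n \<and> ?B \<omega>)
      = \<P>(\<omega> in P. (?B \<omega> \<and> ?C n \<omega>) \<and> \<not> (?B \<omega> \<and> ?C (Suc n) \<omega>))"
    using n by (intro arg_cong[where f = prob]) (auto simp: run_length_eq_iff)
  also have "\<dots> = \<P>(\<omega> in P. ?B \<omega> \<and> ?C n \<omega>) - \<P>(\<omega> in P. ?B \<omega> \<and> ?C (Suc n) \<omega>)"
    by (intro prob_diff) (auto intro: chain_antimono)
  also have "\<dots> = chain_prob n - 2 * chain_prob (Suc n) + chain_prob (Suc (Suc n))"
    using n by (simp add: prob_begins_chain)
  finally show ?thesis
    using False by (simp add: run_length_pgf_def cond_prob_def prob_run_begins_Suc)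
qed (simp add: run_length_pgf_def cond_prob_def run_length_eq_iff)

lemma pgf_0:
  "fps_to_fls (run_length_pgf R P X 0) = (1 + (fls_X - 1) * fps_to_fls (run_function R M)) / fls_X"
proof -
  \<comment> \<open>Multiplied by \<open>Z\<close>, the identity lives in power series and can be
    checked by coefficients; Laurent series enter only for the division.\<close>
  have "fps_X * run_length_pgf R P X 0 = 1 + (fps_X - 1) * run_function R M"
  proof (rule fps_ext)
    fix n show "fps_nth (fps_X * run_length_pgf R P X 0) n
        = fps_nth (1 + (fps_X - 1) * run_function R M) n"
      by (cases n) (simp_all add: pgf_0_nth algebra_simps)
  qed
  from arg_cong[where f = fps_to_fls, OF this]
  have "fls_X * fps_to_fls (run_length_pgf R P X 0)
      = 1 + (fls_X - 1) * fps_to_fls (run_function R M)"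
    by (simp add: fls_times_fps_to_fls fps_to_fls_plus fps_to_fls_minus)
  then show ?thesis
    by (metis fls_X_nonzero mult.commute nonzero_eq_divide_eq)
qed

lemma pgf_Suc:
  assumes "chain_prob 2 \<noteq> 1"
  shows "fps_to_fls (run_length_pgf R P X (Suc i)) =
    1 + 2 * (fls_X - 1) / (fls_X * (2 - fls_const (fps_nth (fps_deriv (fps_deriv (run_function R M))) 0)))
      * fps_to_fls (run_length_pgf R P X 0)"
proof -
  define q where "q = 1 - chain_prob 2"
  have q: "q \<noteq> 0" using assms by (simp add: q_def)
  \<comment> \<open>The claim with its denominators cleared. Coefficients \<open>0\<close> and
    \<open>1\<close> are the boundary cases; from \<open>2\<close> on, both sides are the second
    difference of \<open>chain_prob\<close>.\<close>
  have "fps_const q * (fps_X * run_length_pgf R P X (Suc i))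
      = fps_const q * fps_X + (fps_X - 1) * run_length_pgf R P X 0"
  proof (rule fps_ext)
    fix n
    consider "n = 0" | "n = 1" | m where "n = Suc (Suc m)"
      by (metis One_nat_def not0_implies_Suc)
    then show "fps_nth (fps_const q * (fps_X * run_length_pgf R P X (Suc i))) n
        = fps_nth (fps_const q * fps_X + (fps_X - 1) * run_length_pgf R P X 0) n"
    proof cases
      case 2
      then show ?thesis by (simp add: pgf_0_nth pgf_Suc_nth q_def numeral_2_eq_2)
    next
      case 3
      then show ?thesis
        using q by (simp add: pgf_0_nth pgf_Suc_nth q_def[symmetric]) (simp add: algebra_simps pgf_0_nth)
    qed (simp add: pgf_0_nth)
  qed
  from arg_cong[where f = fps_to_fls, OF this]
  have *: "fls_const q * (fls_X * fps_to_fls (run_length_pgf R P X (Suc i)))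
      = fls_const q * fls_X + (fls_X - 1) * fps_to_fls (run_length_pgf R P X 0)"
    by (simp add: fls_times_fps_to_fls fps_to_fls_plus fps_to_fls_minus fps_const_to_fls)
  \<comment> \<open>The second derivative at \<open>0\<close> is
    \<open>2 * chain_prob 2\<close>.\<close>
  have "2 - fls_const (fps_nth (fps_deriv (fps_deriv (run_function R M))) 0) = 2 * fls_const q"
    by (simp add: q_def numeral_2_eq_2 fls_const_mult_const[symmetric] fls_minus_const[symmetric] algebra_simps)
  moreover have "G = 1 + 2 * (x - 1) / (x * (2 * k)) * H"
    if "k * (x * G) = k * x + (x - 1) * H" "k \<noteq> 0" "x \<noteq> 0" for G H k x :: "real fls"
  proof -
    have "x * k * G = x * k * (1 + (x - 1) / (x * k) * H)"
      using that by (simp add: distrib_left mult.assoc mult.left_commute)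
    moreover have "2 * (x - 1) / (x * (2 * k)) = (x - 1) / (x * k)"
      unfolding mult.left_commute[of x 2 k] by (rule mult_divide_mult_cancel_left) simp
    ultimately show ?thesis using that by simp
  qed
  ultimately show ?thesis
    using * q by simp
qed

section \<open>Bounds on the coefficients\<close>

lemma pgf_nth_nonneg: "0 \<le> fps_nth (run_length_pgf R P X i) n"
  by (simp add: run_length_pgf_def cond_prob_def)

lemma pgf_nth_le_1: "fps_nth (run_length_pgf R P X i) n \<le> 1"
proof -
  have "\<P>(\<omega> in P. run_length R X i \<omega> = enat n \<and> run_begins R X i \<omega>) \<le> \<P>(\<omega> in P. run_begins R X i \<omega>)"
    by (intro finite_measure_mono) auto
  then show ?thesis
    by (auto simp: run_length_pgf_def cond_prob_def divide_le_eq_1 less_le)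
qed

text \<open>A run of length \<open>n\<close> contains a chain of \<open>n\<close> points, so the
  decay of \<open>chain_prob\<close> passes to the generating function.\<close>

lemma pgf_nth_le: "fps_nth (run_length_pgf R P X i) n \<le> chain_prob n / \<P>(\<omega> in P. run_begins R X i \<omega>)"
  unfolding run_length_pgf_def cond_prob_def fps_nth_Abs_fps prob_chain[of i n, symmetric]
  by (intro divide_right_mono finite_measure_mono) (auto simp: run_length_eq_iff)

lemma pgf_conv_radius_ge_1: "fps_conv_radius (run_length_pgf R P X i) \<ge> 1"
  using conv_radius_mono[of "fps_nth (run_length_pgf R P X i)" "\<lambda>_. 1 :: real"]
  by (simp add: fps_conv_radius_def pgf_nth_nonneg pgf_nth_le_1 conv_radius_one)

section \<open>Strict orders: factorial decay\<close>

text \<open>The \<open>n + 1\<close> ways of inserting \<open>X n\<close> into a chain \<open>X 0, \<dots>, X (n - 1)\<close> exclude each other and are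
  equally likely.\<close>

lemma strict_chain_prob_Suc_le:
  assumes "irreflp R" "transp R"
  shows "real (Suc n) * chain_prob (Suc n) \<le> chain_prob n"
proof -
  \<comment> \<open>\<open>s j\<close> places index \<open>n\<close> at position \<open>j\<close>
    and keeps the other indices in order.\<close>
  define s where "s j k = (if k < j then k else if k = j then n else k - 1)" for j k :: nat
  have inj: "inj_on (s j) {..<Suc n}" if "j \<le> n" for j
    using that by (intro inj_onI) (auto simp: s_def split: if_splits)
  define E where "E j = {\<omega> \<in> space P. chain (s j) (Suc n) \<omega>}" for j
  have E_meas [measurable]: "E j \<in> events" for j by (simp add: E_def)
  have E_less: "R (X (s j a) \<omega>) (X (s j b) \<omega>)" if "\<omega> \<in> E j" "a < b" "b \<le> n" for j a b \<omega>
    using that(2,3)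
  proof (induction b)
    case (Suc b)
    have "R (X (s j b) \<omega>) (X (s j (Suc b)) \<omega>)"
      using that(1) Suc.prems by (auto simp: E_def chain_def)
    with Suc show ?case
      using transpD[OF assms(2)] by (cases "a = b") auto
  qed simp
  \<comment> \<open>On \<open>E j\<close> the inserted \<open>X n\<close> lies below
    \<open>X j\<close>, on \<open>E j'\<close> above it.\<close>
  have "E j \<inter> E j' = {}" if "j < j'" "j' \<le> n" for j j'
  proof (rule ccontr)
    assume "E j \<inter> E j' \<noteq> {}"
    then obtain \<omega> where "\<omega> \<in> E j" "\<omega> \<in> E j'" by auto
    then have "R (X n \<omega>) (X j \<omega>)" "R (X j \<omega>) (X n \<omega>)"
      using E_less[of \<omega> j j "Suc j"] E_less[of \<omega> j' j j'] that by (auto simp: s_def)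
    then show False
      using assms by (meson irreflpD transpD)
  qed
  then have "disjoint_family_on E {..n}"
    unfolding disjoint_family_on_def by (metis atMost_iff inf_commute linorder_neqE_nat)
  then have "prob (\<Union>j\<le>n. E j) = (\<Sum>j\<le>n. prob (E j))"
    by (intro finite_measure_finite_Union) auto
  also have "\<dots> = real (Suc n) * chain_prob (Suc n)"
    using run_function_nth[OF inj] by (simp add: E_def)
  finally have "real (Suc n) * chain_prob (Suc n) = prob (\<Union>j\<le>n. E j)" ..
  also have "\<dots> \<le> \<P>(\<omega> in P. chain ((+) 0) n \<omega>)"
  proof (rule finite_measure_mono)
    show "(\<Union>j\<le>n. E j) \<subseteq> {\<omega> \<in> space P. chain ((+) 0) n \<omega>}"
    proof
      fix \<omega> assume "\<omega> \<in> (\<Union>j\<le>n. E j)"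
      then obtain j where j: "j \<le> n" "\<omega> \<in> E j" by auto
      have "R (X k \<omega>) (X (Suc k) \<omega>)" if "Suc k < n" for k
      proof -
        \<comment> \<open>In the middle case \<open>X n\<close> separates the two neighbours, and
          transitivity skips it.\<close>
        consider "Suc k < j" | "Suc k = j" | "j \<le> k" by linarith
        then show ?thesis
        proof cases
          case 1
          then show ?thesis using E_less[OF j(2), of k "Suc k"] that by (simp add: s_def)
        next
          case 2
          then show ?thesis using E_less[OF j(2), of k "Suc (Suc k)"] that by (simp add: s_def)
        next
          case 3
          then show ?thesis using E_less[OF j(2), of "Suc k" "Suc (Suc k)"] that by (simp add: s_def)
        qed
      qed
      with j(2) show "\<omega> \<in> {\<omega> \<in> space P. chain ((+) 0) n \<omega>}"
        by (auto simp: chain_def E_def)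
    qed
  qed simp
  finally show ?thesis by (simp only: prob_chain)
qed

lemma strict_chain_prob_le_inverse_fact:
  assumes "irreflp R" "transp R"
  shows "chain_prob n \<le> 1 / fact n"
proof (induction n)
  case (Suc n)
  have "chain_prob (Suc n) \<le> chain_prob n / real (Suc n)"
    using strict_chain_prob_Suc_le[OF assms, of n] by (simp add: field_simps)
  also have "\<dots> \<le> (1 / fact n) / real (Suc n)"
    by (intro divide_right_mono Suc.IH) simp
  finally show ?case by (simp add: field_simps)
qed simp

lemma strict_conv_radius:
  assumes "irreflp R" "transp R"
  shows "fps_conv_radius (run_length_pgf R P X i) = \<infinity>"
proof -
  define q where "q = \<P>(\<omega> in P. run_begins R X i \<omega>)"
  \<comment> \<open>A run begins at \<open>0\<close> surely, and later with probability at least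
    \<open>1/2\<close>, since \<open>chain_prob 2 \<le> 1/2\<close>.\<close>
  have q: "0 < q"
    using strict_chain_prob_le_inverse_fact[OF assms, of 2]
    by (cases i) (simp_all add: q_def prob_run_begins_Suc, simp add: run_begins_def prob_space)
  have "fps_nth (run_length_pgf R P X i) n \<le> fps_nth (fps_const (1 / q) * fps_exp 1) n" for n
  proof -
    have "fps_nth (run_length_pgf R P X i) n \<le> chain_prob n / q"
      unfolding q_def by (rule pgf_nth_le)
    also have "\<dots> \<le> (1 / fact n) / q"
      using q by (intro divide_right_mono strict_chain_prob_le_inverse_fact assms) auto
    finally show ?thesis by (simp add: field_simps)
  qed
  then have "conv_radius (fps_nth (fps_const (1 / q) * fps_exp 1))
      \<le> conv_radius (fps_nth (run_length_pgf R P X i))"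
    by (intro conv_radius_mono) (simp add: pgf_nth_nonneg abs_of_nonneg q less_imp_le)
  moreover have "fps_conv_radius (fps_const (1 / q) * fps_exp 1) = \<infinity>"
    using q by (subst fps_conv_radius_cmult_left) auto
  ultimately show ?thesis
    by (simp add: fps_conv_radius_def)
qed

section \<open>Weak orders and degenerate laws\<close>

lemma degenerate_if_chain_prob_2_eq_1:
  assumes "antisymp R" "chain_prob 2 = 1"
  shows "degenerate M"
proof -
  interpret MM: pair_sigma_finite M M ..
  \<comment> \<open>\<open>chain_prob 2\<close> does not depend on the two indices or their order,
    so the relation holds almost surely both ways.\<close>
  have AE: "AE \<omega> in P. R (X i \<omega>) (X j \<omega>)" if "i \<noteq> j" for i j
  proof -
    have "inj_on (\<lambda>k :: nat. if k = 0 then i else j) {..<2}"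
      using that by (auto simp: inj_on_def less_2_cases_iff)
    from run_function_nth[OF this] have "\<P>(\<omega> in P. R (X i \<omega>) (X j \<omega>)) = 1"
      using assms(2) by (simp add: chain_def numeral_2_eq_2 less_Suc_eq)
    then show ?thesis by (subst (asm) prob_Collect_eq_1) auto
  qed
  have "AE \<omega> in P. R (X 0 \<omega>) (X 1 \<omega>) \<and> R (X 1 \<omega>) (X 0 \<omega>)"
    using AE[of 0 1] AE[of 1 0] by simp
  then have "AE p in distr P (M \<Otimes>\<^sub>M M) (\<lambda>\<omega>. (X 0 \<omega>, X 1 \<omega>)). R (fst p) (snd p) \<and> R (snd p) (fst p)"
    by (subst AE_distr_iff) auto
  then have "AE p in M \<Otimes>\<^sub>M M. R (fst p) (snd p) \<and> R (snd p) (fst p)"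
    by (simp only: distr_pair[OF zero_neq_one])
  then have "AE x in M. AE y in M. R x y \<and> R y x"
    using MM.AE_pair by force
  \<comment> \<open>A property that holds almost everywhere on a probability space holds at some
    point.\<close>
  then have "\<exists>x\<in>space M. AE y in M. R x y \<and> R y x"
    using M.AE_False by (metis (no_types, lifting) AE_cong)
  then obtain x where x: "x \<in> space M" and y: "AE y in M. R x y \<and> R y x" by auto
  have [measurable]: "Measurable.pred M (\<lambda>y. R x y \<and> R y x)"
    using x by measurable
  have "M.prob {y \<in> space M. R x y \<and> R y x} = 1"
    using y by (subst M.prob_Collect_eq_1) auto
  moreover have "{y \<in> space M. R x y \<and> R y x} \<in> sets M" by measurable
  moreover from calculation have "{y \<in> space M. R x y \<and> R y x} \<noteq> {}"
    by force
  \<comment> \<open>By antisymmetry a nonempty such set is \<open>{x}\<close>; this also yields the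
    measurability of \<open>{x}\<close> that \<open>degenerate\<close> demands.\<close>
  then have "{y \<in> space M. R x y \<and> R y x} = {x}"
    using assms(1) by (auto dest: antisympD)
  ultimately show ?thesis
    unfolding degenerate_def using x by (auto simp: M.prob_space)
qed

text \<open>Almost surely all variables sit at the atom, and by reflexivity a constant sequence is a
  chain.\<close>

lemma chain_prob_eq_1_if_degenerate:
  assumes "reflp R" "degenerate M"
  shows "chain_prob n = 1"
proof -
  obtain x where x: "{x} \<in> sets M" "M.prob {x} = 1"
    using assms(2) by (auto simp: degenerate_def M.prob_space)
  note [measurable] = x(1)
  have "\<P>(\<omega> in P. X i \<omega> \<in> {x}) = 1" for i
    using measure_distr[OF measurable_X x(1), of i] x(2)
    by (simp add: law vimage_def Int_def conj_commute)
  then have "AE \<omega> in P. X i \<omega> = x" for i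
    by (subst (asm) prob_Collect_eq_1) auto
  then have "AE \<omega> in P. \<forall>i. X i \<omega> = x"
    by (simp add: AE_all_countable)
  then have "AE \<omega> in P. chain ((+) 0) n \<omega>"
    by eventually_elim (use assms(1) in \<open>auto simp: chain_def reflpD\<close>)
  then show ?thesis
    unfolding prob_chain[of 0 n, symmetric] by (subst prob_Collect_eq_1) auto
qed

end

section \<open>Application to \<open><\<close> and \<open>\<le>\<close>\<close>

theorem theorem3:
  fixes \<mu> :: "'a :: {order, topological_space} measure"
    and P :: "'w measure"
    and X :: "nat \<Rightarrow> 'w \<Rightarrow> 'a"
  assumes "prob_space \<mu>" and "sets \<mu> = sets borel"
    and "{(x, y). x < y} \<in> sets (\<mu> \<Otimes>\<^sub>M \<mu>)"
    and "prob_space P"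
    and "prob_space.indep_vars P (\<lambda>_. borel) X UNIV"
    and "\<And>i. distr P borel (X i) = \<mu>"
  shows
    "(fps_to_fls (run_length_pgf (<) P X 0) =
        (1 + (fls_X - 1) * fps_to_fls (run_function (<) \<mu>)) / fls_X) \<and>
     (\<forall>i\<ge>1. fps_to_fls (run_length_pgf (<) P X i) =
        1 + 2 * (fls_X - 1) /
              (fls_X * (2 - fls_const (fps_nth (fps_deriv (fps_deriv (run_function (<) \<mu>))) 0)))
            * fps_to_fls (run_length_pgf (<) P X 0)) \<and>
     (\<forall>i. fps_conv_radius (run_length_pgf (<) P X i) = \<infinity>) \<and>
     ({(x, y). x \<le> y} \<in> sets (\<mu> \<Otimes>\<^sub>M \<mu>) \<longrightarrow>
        (fps_to_fls (run_length_pgf (\<le>) P X 0) =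
           (1 + (fls_X - 1) * fps_to_fls (run_function (\<le>) \<mu>)) / fls_X) \<and>
        (\<not> degenerate \<mu> \<longrightarrow>
           (\<forall>i\<ge>1. fps_to_fls (run_length_pgf (\<le>) P X i) =
              1 + 2 * (fls_X - 1) /
                    (fls_X * (2 - fls_const (fps_nth (fps_deriv (fps_deriv (run_function (\<le>) \<mu>))) 0)))
                  * fps_to_fls (run_length_pgf (\<le>) P X 0))) \<and>
        (\<forall>i. fps_conv_radius (run_length_pgf (\<le>) P X i) \<ge> ereal (1 / measure \<mu> (space \<mu>))) \<and>
        (degenerate \<mu> \<longrightarrow>
           fps_conv_radius (run_function (\<le>) \<mu>) = ereal (1 / measure \<mu> (space \<mu>))))"
proof -
  have space: "space \<mu> = UNIV" using sets_eq_imp_space_eq[OF assms(2)] by simp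
  have iid: "iid_relation P \<mu> X R" if "{(x, y). R x y} \<in> sets (\<mu> \<Otimes>\<^sub>M \<mu>)" for R
  proof -
    interpret prob_space P by fact
    have "prob_space.indep_vars P (\<lambda>_. \<mu>) X UNIV"
      using assms(5) by (simp add: indep_vars_def assms(2) cong: measurable_cong_sets)
    moreover have "distr P \<mu> (X i) = \<mu>" for i
      using assms(2,6) distr_cong[of P P \<mu> borel "X i" "X i"] by simp
    moreover have "Measurable.pred (\<mu> \<Otimes>\<^sub>M \<mu>) (\<lambda>p. R (fst p) (snd p))"
      using that by (simp add: pred_def space_pair_measure space case_prod_unfold)
    ultimately show ?thesis by unfold_locales
  qed
  interpret strict: iid_relation P \<mu> X "(<)" by (rule iid) fact
  have strict: "irreflp ((<) :: 'a \<Rightarrow> _)" "transp ((<) :: 'a \<Rightarrow> _)"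
    by simp_all
  \<comment> \<open>The bound \<open>1/2\<close> keeps the denominator nonzero for every
    \<open>\<mu>\<close>.\<close>
  have "strict.chain_prob 2 \<noteq> 1"
    using strict.strict_chain_prob_le_inverse_fact[OF strict, of 2] by simp
  note strict_facts = strict.pgf_0 strict.pgf_Suc[OF this] strict.strict_conv_radius[OF strict]
  have weak_facts: "fps_to_fls (run_length_pgf (\<le>) P X 0) =
        (1 + (fls_X - 1) * fps_to_fls (run_function (\<le>) \<mu>)) / fls_X"
      "\<not> degenerate \<mu> \<Longrightarrow> fps_to_fls (run_length_pgf (\<le>) P X (Suc i)) =
        1 + 2 * (fls_X - 1) /
              (fls_X * (2 - fls_const (fps_nth (fps_deriv (fps_deriv (run_function (\<le>) \<mu>))) 0)))
            * fps_to_fls (run_length_pgf (\<le>) P X 0)"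
      "fps_conv_radius (run_length_pgf (\<le>) P X i) \<ge> ereal (1 / measure \<mu> (space \<mu>))"
      "degenerate \<mu> \<Longrightarrow> fps_conv_radius (run_function (\<le>) \<mu>) = ereal (1 / measure \<mu> (space \<mu>))"
    if "{(x, y). x \<le> y} \<in> sets (\<mu> \<Otimes>\<^sub>M \<mu>)" for i
  proof -
    interpret weak: iid_relation P \<mu> X "(\<le>)" by (rule iid) fact
    show "fps_to_fls (run_length_pgf (\<le>) P X 0) =
        (1 + (fls_X - 1) * fps_to_fls (run_function (\<le>) \<mu>)) / fls_X"
      by (rule weak.pgf_0)
    show "fps_to_fls (run_length_pgf (\<le>) P X (Suc i)) =
        1 + 2 * (fls_X - 1) /
              (fls_X * (2 - fls_const (fps_nth (fps_deriv (fps_deriv (run_function (\<le>) \<mu>))) 0)))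
            * fps_to_fls (run_length_pgf (\<le>) P X 0)" if "\<not> degenerate \<mu>"
      using that weak.degenerate_if_chain_prob_2_eq_1 by (intro weak.pgf_Suc) auto
    show "fps_conv_radius (run_length_pgf (\<le>) P X i) \<ge> ereal (1 / measure \<mu> (space \<mu>))"
      using weak.pgf_conv_radius_ge_1[of i] by (simp add: strict.M.prob_space one_ereal_def)
    \<comment> \<open>All coefficients are \<open>1\<close>, a geometric series. The radius is that
      of the run function: weak runs here almost surely never end, so the coefficients of
      \<open>run_length_pgf\<close> all vanish.\<close>
    show "fps_conv_radius (run_function (\<le>) \<mu>) = ereal (1 / measure \<mu> (space \<mu>))" if "degenerate \<mu>"
      using weak.chain_prob_eq_1_if_degenerate[OF _ that] conv_radius_one
      by (simp add: fps_conv_radius_def strict.M.prob_space one_ereal_def)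
  qed
  have Suc: "(\<forall>i\<ge>1. Q i) \<longleftrightarrow> (\<forall>i. Q (Suc i))" for Q
    by (metis One_nat_def Suc_le_D Suc_le_mono le0)
  show ?thesis
    unfolding Suc using strict_facts weak_facts by blast
qed

end
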